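(* For any (nonempty) sequence $u$, either $\operatorname{Sat}(u,n)\ge n$ for every positive integer $n$, or $\operatorname{Sat}(u,n)=O(1)$.
   Context: Sequences are finite words over an alphabet; a sequence on a given alphabet takes its letters from that alphabet (not every letter is required to appear). Two sequences are isomorphic if one is obtained from the other by a one-to-one renaming of letters. A sequence contains a copy of $u$ if some (not necessarily contiguous) subsequence of it is isomorphic to $u$; otherwise it is $u$-free. For a positive integer $m$, a sequence is $m$-sparse if any $m$ consecutive letters are distinct, meaning that any two occurrences of the same letter are at positions differing by at least $m$ (also for sequences shorter than $m$). Let $\|u\|$ be the number of distinct letters of $u$. A sequence $s$ on a given alphabet is $u$-saturated if $s$ is $\|u\|$-sparse, $u$-free, and inserting any letter of the alphabet at any position of $s$ (including the beginning or the end) violates $\|u\|$-sparsity or creates a copy of $u$. $\operatorname{Sat}(u,n)$ is the minimum possible length of a $u$-saturated sequence on an alphabet of size $n$. Asymptotic notation is for fixed $u$ as $n\to\infty$. *)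

theory Defs
  imports Complex_Main "HOL-Library.Sublist" "HOL-Library.Landau_Symbols"
begin

definition isomorphic :: "'a list \<Rightarrow> 'b list \<Rightarrow> bool" where
  "isomorphic u v \<longleftrightarrow> (\<exists>f. inj_on f (set u) \<and> v = map f u)"

definition contains_copy :: "'b list \<Rightarrow> 'a list \<Rightarrow> bool" where
  "contains_copy s u \<longleftrightarrow> (\<exists>v. subseq v s \<and> isomorphic u v)"

definition sparse :: "nat \<Rightarrow> 'a list \<Rightarrow> bool" where
  "sparse m s \<longleftrightarrow> (\<forall>i j. i < j \<and> j < length s \<and> s ! i = s ! j \<longrightarrow> m \<le> j - i)"

definition num_letters :: "'a list \<Rightarrow> nat" where
  "num_letters u = card (set u)"

definition insert_at :: "nat \<Rightarrow> 'a \<Rightarrow> 'a list \<Rightarrow> 'a list" where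
  "insert_at i x s = take i s @ x # drop i s"

definition saturated :: "'a list \<Rightarrow> 'b set \<Rightarrow> 'b list \<Rightarrow> bool" where
  "saturated u A s \<longleftrightarrow>
     set s \<subseteq> A \<and>
     sparse (num_letters u) s \<and>
     \<not> contains_copy s u \<and>
     (\<forall>x\<in>A. \<forall>i\<le>length s.
        \<not> sparse (num_letters u) (insert_at i x s) \<or> contains_copy (insert_at i x s) u)"

text \<open>
  Every finite alphabet can be renamed into the natural numbers, so it suffices to let
  the alphabets be sets of naturals.  For nonempty \<open>u\<close> the minimum is attained: the length of
  a \<open>u\<close>-free sequence over a finite alphabet that is sparse with respect to the number of
  letters of \<open>u\<close> is bounded, so one of maximal length exists, and it is saturated.
\<close>

definition Sat :: "'a list \<Rightarrow> nat \<Rightarrow> nat" where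
  "Sat u n = (LEAST l. \<exists>(A :: nat set) s. finite A \<and> card A = n \<and> saturated u A s \<and> length s = l)"

end

theory Submission
  imports Defs
begin

text \<open>
  Suppose a saturated sequence \<open>s\<close> on \<open>n\<close> letters is shorter than \<open>n\<close>. Then some letter \<open>x\<close> of
  the alphabet does not occur in \<open>s\<close>. Inserting \<open>x\<close> anywhere cannot violate sparsity, so every
  such insertion creates a copy of \<open>u\<close>. A letter outside the alphabet behaves exactly like \<open>x\<close>,
  up to renaming, so \<open>s\<close> stays saturated when the alphabet is enlarged
  (\<open>saturated_enlarge_alphabet\<close>), and its length bounds \<open>Sat u N\<close> for all \<open>N \<ge> n\<close>.

  To get \<open>s\<close> from \<open>Sat u n < n\<close>, the minimum defining \<open>Sat\<close> has to be taken over a nonempty set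
  (\<open>saturated_exists\<close>). A longest sparse \<open>u\<close>-free sequence is saturated, so it suffices
  to bound the lengths of such sequences (\<open>sparse_free_length_bound\<close>). This is a pigeonhole
  argument: cut the sequence into blocks of length \<open>num_letters u\<close>; if there are many blocks,
  one word \<open>w\<close> occurs as a block at least \<open>length u\<close> times. By sparsity \<open>w\<close> has as many distinct
  letters as \<open>u\<close>, and a copy of \<open>u\<close> arises by taking one letter from each occurrence of \<open>w\<close>.
\<close>

section \<open>Insertion and renaming of letters\<close>

lemma contains_copy_map_inj:
  assumes "contains_copy s u" "inj_on g (set s)"
  shows "contains_copy (map g s) u"
proof -
  obtain f where f: "subseq (map f u) s" "inj_on f (set u)"
    using assms(1) by (auto simp: contains_copy_def isomorphic_def)
  have "set (map f u) \<subseteq> set s"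
    by (rule subsetI, erule list_emb_set[OF f(1)]) simp
  then have "inj_on (g \<circ> f) (set u)"
    using f(2) assms(2) by (auto intro!: comp_inj_on intro: inj_on_subset)
  moreover have "subseq (map (g \<circ> f) u) (map g s)"
    using subseq_map[OF f(1), of g] by simp
  ultimately show ?thesis
    by (auto simp: contains_copy_def isomorphic_def)
qed

text \<open>Insertion only increases distances between old letters, and a new letter occurs just once.\<close>

lemma sparse_insert_fresh:
  assumes "sparse m s" "x \<notin> set s" "i \<le> length s"
  shows "sparse m (insert_at i x s)"
  unfolding sparse_def
proof (intro allI impI, elim conjE)
  fix a b
  assume ab: "a < b" "b < length (insert_at i x s)"
    and eq: "insert_at i x s ! a = insert_at i x s ! b"
  have len: "length (insert_at i x s) = Suc (length s)"
    using assms(3) by (simp add: insert_at_def)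
  define old where "old j = (if j < i then j else j - 1)" for j
  have at_i: "insert_at i x s ! i = x"
    using assms(3) by (simp add: insert_at_def nth_append)
  have old: "insert_at i x s ! j = s ! old j \<and> old j < length s"
    if "j \<noteq> i" "j < Suc (length s)" for j
    using that assms(3)
    by (auto simp: insert_at_def old_def nth_append nth_Cons' not_less min_def)
  have other: "insert_at i x s ! j \<noteq> x" if "j \<noteq> i" "j < Suc (length s)" for j
    using old[OF that] assms(2) nth_mem[of "old j" s] by auto
  have "a \<noteq> i" "b \<noteq> i"
    using eq at_i other[of a] other[of b] ab len by auto
  then have "s ! old a = s ! old b" "old a < old b" "old b < length s"
    using eq old[of a] old[of b] ab len by (auto simp: old_def)
  then have "m \<le> old b - old a"
    using assms(1) unfolding sparse_def by blast
  also have "old b - old a \<le> b - a"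
    using \<open>a < b\<close> by (auto simp: old_def)
  finally show "m \<le> b - a" .
qed

lemma contains_copy_insert_fresh_swap:
  assumes "contains_copy (insert_at i x s) u" "x \<notin> set s" "y \<notin> set s"
  shows "contains_copy (insert_at i y s) u"
proof -
  let ?g = "id(x := y)"
  have sub: "set (take i s) \<subseteq> set s" "set (drop i s) \<subseteq> set s"
    by (rule set_take_subset set_drop_subset)+
  have fixed: "map ?g t = t" if "set t \<subseteq> set s" for t
    using that assms(2) by (auto intro!: map_idI)
  have "map ?g (insert_at i x s) = insert_at i y s"
    using fixed[OF sub(1)] fixed[OF sub(2)] by (simp add: insert_at_def)
  moreover have "inj_on ?g (set (insert_at i x s))"
    using sub assms(3) by (auto simp: inj_on_def insert_at_def)
  ultimately show ?thesis
    using contains_copy_map_inj[OF assms(1), of ?g] by simp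
qed

lemma saturated_enlarge_alphabet:
  assumes sat: "saturated u A s" and x: "x \<in> A" "x \<notin> set s" and "A \<subseteq> B"
  shows "saturated u B s"
  unfolding saturated_def
proof (intro conjI ballI allI impI)
  show "set s \<subseteq> B" "sparse (num_letters u) s" "\<not> contains_copy s u"
    using sat \<open>A \<subseteq> B\<close> by (auto simp: saturated_def)
  fix y i
  assume "i \<le> length s"
  show "\<not> sparse (num_letters u) (insert_at i y s) \<or> contains_copy (insert_at i y s) u"
  proof (cases "y \<in> A")
    case True
    then show ?thesis
      using sat \<open>i \<le> length s\<close> by (simp add: saturated_def)
  next
    case False
    have "contains_copy (insert_at i x s) u"
      using sat x \<open>i \<le> length s\<close> sparse_insert_fresh[of "num_letters u" s x i]
      by (auto simp: saturated_def)
    moreover have "y \<notin> set s"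
      using False sat by (auto simp: saturated_def)
    ultimately show ?thesis
      using contains_copy_insert_fresh_swap[of i x s u y] x(2) by blast
  qed
qed

section \<open>Existence of saturated sequences\<close>

lemma split_into_blocks:
  assumes "r * k \<le> length s"
  shows "\<exists>bs t. s = concat bs @ t \<and> length bs = k \<and> (\<forall>b\<in>set bs. length b = r)"
  using assms
proof (induction k arbitrary: s)
  case 0
  show ?case by (rule exI[of _ "[]"]) simp
next
  case (Suc k)
  then have "r * k \<le> length (drop r s)" by simp
  then obtain bs t where "drop r s = concat bs @ t" "length bs = k" "\<forall>b\<in>set bs. length b = r"
    using Suc.IH by blast
  then show ?case
    using Suc.prems append_take_drop_id[of r s]
    by (intro exI[of _ "take r s # bs"] exI[of _ t]) auto
qed

lemma sparse_imp_distinct_factor: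
  assumes "sparse m (p @ b @ q)" "length b \<le> m"
  shows "distinct b"
proof -
  have "b ! i \<noteq> b ! j" if "i < j" "j < length b" for i j
  proof
    assume "b ! i = b ! j"
    then have "m \<le> (length p + j) - (length p + i)"
      using assms(1)[unfolded sparse_def, rule_format, of "length p + i" "length p + j"] that
      by (simp add: nth_append)
    then show False using that assms(2) by simp
  qed
  then have "b ! i \<noteq> b ! j" if "i \<noteq> j" "i < length b" "j < length b" for i j
    using that by (cases i j rule: linorder_cases) force+
  then show ?thesis
    by (simp add: distinct_conv_nth)
qed

lemma subseq_concat_repeated_block:
  assumes "set v \<subseteq> set w" "length v \<le> count_list bs w"
  shows "subseq v (concat bs)"
  using assms
proof (induction bs arbitrary: v)
  case Nil
  then show ?case by simp
next
  case (Cons b bs)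
  show ?case
  proof (cases "b = w \<and> v \<noteq> []")
    case True
    then obtain a v' where v: "v = a # v'" by (cases v) auto
    have "subseq [a] b"
      using Cons.prems True v by (simp add: subseq_singleton_left)
    moreover have "subseq v' (concat bs)"
      using Cons.prems True v by (intro Cons.IH) auto
    ultimately have "subseq ([a] @ v') (b @ concat bs)"
      by (rule list_emb_append_mono)
    then show ?thesis using v by simp
  next
    case False
    then have "subseq v (concat bs)"
      using Cons by (cases "v = []") auto
    then show ?thesis by (simp add: subseq_drop_many)
  qed
qed

text \<open>
  The bound is \<open>num_letters u\<close> times one more than \<open>length u\<close> times the number of words of that length
  over \<open>A\<close>: a sequence at least this long has so many blocks that some word is a block
  more than \<open>length u\<close> times.
\<close>

lemma sparse_free_length_bound:
  fixes u :: "'a list" and A :: "'b set"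
  assumes "finite A"
  shows "\<exists>N. \<forall>s. set s \<subseteq> A \<and> sparse (num_letters u) s \<and> \<not> contains_copy s u \<longrightarrow> length s < N"
proof -
  define r where "r = num_letters u"
  define W where "W = {w. set w \<subseteq> A \<and> length w = r}"
  define k where "k = Suc (card W * length u)"
  have "finite W"
    unfolding W_def by (rule finite_lists_length_eq[OF assms])
  have "contains_copy s u" if s: "set s \<subseteq> A" "sparse r s" and long: "r * k \<le> length s" for s
  proof -
    obtain bs t where bs: "s = concat bs @ t" "length bs = k" "\<forall>b\<in>set bs. length b = r"
      using split_into_blocks[OF long] by blast
    have "set bs \<subseteq> W"
      using s(1) bs by (auto simp: W_def)
    then have total: "(\<Sum>w\<in>W. count_list bs w) = k"
      using sum_count_set[of bs W] \<open>finite W\<close> bs(2) by simp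
    have "\<exists>w\<in>W. length u < count_list bs w"
    proof (rule ccontr)
      assume "\<not> ?thesis"
      then have "(\<Sum>w\<in>W. count_list bs w) \<le> card W * length u"
        using sum_bounded_above[of W "count_list bs" "length u"] by (auto simp: not_less)
      then show False using total by (simp add: k_def)
    qed
    then obtain w where w: "length u < count_list bs w" by blast
    then have "w \<in> set bs"
      using count_notin[of w bs] by fastforce
    then have lw: "length w = r" using bs(3) by blast
    obtain ys zs where "bs = ys @ w # zs"
      using split_list[OF \<open>w \<in> set bs\<close>] by blast
    then have "s = concat ys @ w @ concat zs @ t" using bs(1) by simp
    then have "distinct w"
      using sparse_imp_distinct_factor[of r "concat ys" w "concat zs @ t"] s(2) lw by simp
    then have "card (set w) = card (set u)"
      using lw by (simp add: distinct_card r_def num_letters_def)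
    then obtain f where f: "bij_betw f (set u) (set w)"
      using finite_same_card_bij[of "set u" "set w"] by auto
    then have "subseq (map f u) (concat bs)"
      using w by (intro subseq_concat_repeated_block[of _ w]) (auto simp: bij_betw_def)
    then have "subseq (map f u) s"
      using bs(1) by (auto intro: list_emb_append2)
    then show ?thesis
      using f by (auto simp: contains_copy_def isomorphic_def bij_betw_def)
  qed
  then show ?thesis
    unfolding r_def[symmetric] using linorder_not_le by blast
qed

lemma saturated_exists:
  fixes u :: "'a list" and A :: "'b set"
  assumes "u \<noteq> []" "finite A"
  shows "\<exists>s. saturated u A s"
proof -
  define P where
    "P s \<longleftrightarrow> set s \<subseteq> A \<and> sparse (num_letters u) s \<and> \<not> contains_copy s u" for s
  have "v = []" if "subseq v []" for v :: "'b list"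
    using list_emb_Nil2[OF that] .
  then have "\<not> contains_copy ([] :: 'b list) u"
    using assms(1) unfolding contains_copy_def isomorphic_def by (metis map_is_Nil_conv)
  then have "P []"
    by (simp add: P_def sparse_def)
  obtain N where "\<forall>s. P s \<longrightarrow> length s < N"
    using sparse_free_length_bound[OF assms(2), of u] unfolding P_def by blast
  then obtain s where s: "P s" and max: "\<And>t. P t \<Longrightarrow> length t \<le> length s"
    using ex_has_greatest_nat[of P "[]" length N] \<open>P []\<close> by auto
  have "\<not> P (insert_at i x s)" if "i \<le> length s" for i x
    using max[of "insert_at i x s"] that by (auto simp: insert_at_def)
  moreover have "set (insert_at i x s) \<subseteq> A" if "x \<in> A" for i x
    using s that by (auto simp: P_def insert_at_def dest: in_set_takeD in_set_dropD)
  ultimately have "saturated u A s"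
    using s unfolding P_def saturated_def by blast
  then show ?thesis ..
qed

lemma Sat_attained:
  assumes "u \<noteq> []"
  obtains A :: "nat set" and s
  where "finite A" "card A = n" "saturated u A s" "length s = Sat u n"
proof -
  let ?Q = "\<lambda>l. \<exists>(A :: nat set) s. finite A \<and> card A = n \<and> saturated u A s \<and> length s = l"
  obtain s where "saturated u {..<n} s"
    using saturated_exists[OF assms, of "{..<n}"] by auto
  then have "?Q (length s)"
    by (intro exI[of _ "{..<n}"] exI[of _ s]) simp
  then have "?Q (Sat u n)"
    unfolding Sat_def by (rule LeastI)
  then show ?thesis using that by blast
qed

section \<open>The dichotomy\<close>

theorem lemma3p9:
  fixes u :: "'a list"
  assumes "u \<noteq> []"
  shows "(\<forall>n\<ge>1. Sat u n \<ge> n) \<or> (\<lambda>n. real (Sat u n)) \<in> O(\<lambda>_. 1)"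
proof (cases "\<forall>n\<ge>1. Sat u n \<ge> n")
  case True
  then show ?thesis ..
next
  case False
  then obtain n where "Sat u n < n" by (auto simp: not_le)
  obtain A :: "nat set" and s
    where A: "finite A" "card A = n" and s: "saturated u A s" "length s = Sat u n"
    using Sat_attained[OF assms] by blast
  have "card (set s) < card A"
    using card_length[of s] s(2) A(2) \<open>Sat u n < n\<close> by simp
  then have "\<not> A \<subseteq> set s"
    using card_mono[of "set s" A] by auto
  then obtain x where x: "x \<in> A" "x \<notin> set s" by blast
  have bound: "Sat u N \<le> length s" if "n \<le> N" for N
  proof -
    have "infinite (UNIV - A)" using A(1) by simp
    then obtain C where C: "C \<subseteq> UNIV - A" "finite C" "card C = N - n"
      using infinite_arbitrarily_large by blast
    have "card (A \<union> C) = N"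
      using A C that by (subst card_Un_disjoint) auto
    moreover have "saturated u (A \<union> C) s"
      by (rule saturated_enlarge_alphabet[OF s(1) x]) simp
    ultimately show ?thesis
      unfolding Sat_def using A(1) C(2)
      by (intro Least_le exI[of _ "A \<union> C"] exI[of _ s]) simp
  qed
  have "(\<lambda>n. real (Sat u n)) \<in> O(\<lambda>_. 1)"
    by (rule bigoI[where c = "real (length s)"])
      (auto simp: eventually_at_top_linorder intro!: exI[of _ n] bound)
  then show ?thesis ..
qed

end
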